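(* Let $k$ be a field of characteristic zero, let $R$ be a PID containing $k$, let $B=R[X_1,X_2]$ be the polynomial ring in two variables over $R$, and let $D$ be an irreducible locally nilpotent $R$-derivation on $B$ satisfying the following conditions: (i) $DX_1=\prod_{i\in I}p_i^{r_i}\in R$, where $I=\{1,2,\dots,n\}$ and for each $i\in I$, $p_i$ is a prime element of $R$ (and $r_i$ is a positive integer); (ii) $DX_2=-f'(X_1)$, where $f(X_1)=\sum_{j=0}^{d}f_jX_1^j$, $f_j\in R$ for $0\leqslant j\leqslant d$ and $f_d\neq 0$. Let $A=\mathrm{Ker}(D)$, let $I_j=A\cap D^jB$ denote the $j$-th image ideal of $D$, and let $J=\{i\in I: p_i\mid f_j\text{ for all }j=2,\dots,d\text{ and }p_i\nmid f_1\}$. Then the following hold. (I) $I_1=\Big(\prod_{i\in I\setminus J}p_i^{r_i}\Big)A$ if $J\neq I$, and $I_1=A$ if $J=I$. (II) If $p_i\nmid f_d$ for each $i\in I$, then for each integer $j\geqslant 1$, $I_j=(DX_1)^{m_j}A$, where $m_j=\min\{i_1+(d-1)i_2: i_1,i_2\in\mathbb{N},\ i_1+di_2=j\}$.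
   Context: All rings are commutative with unity; $\mathbb{N}$ is the set of non-negative integers. A locally nilpotent $R$-derivation on an $R$-algebra $B$ is an $R$-linear map $D:B\to B$ satisfying the Leibniz rule such that for each $b\in B$ there is $n\in\mathbb{N}$ with $D^n b=0$; $\mathrm{Ker}(D)=\{b\in B: Db=0\}$. For $j\geqslant 1$, the $j$-th image ideal of $D$ is the ideal $I_j=\mathrm{Ker}(D)\cap D^jB$ of $\mathrm{Ker}(D)$. $D$ is irreducible if there is no non-unit $b\in B$ with $DB\subseteq bB$. Here $f'$ is the derivative of $f$ with respect to $X_1$, and coefficients $f_j$ with $j>d$ are understood to be $0$. *)

theory Defs
  imports "HOL-Computational_Algebra.Computational_Algebra"
begin

class principal_ideal_domain = idom +
  assumes ideal_principal:
    "\<lbrakk>0 \<in> I; \<forall>x\<in>I. \<forall>y\<in>I. x + y \<in> I; \<forall>a. \<forall>x\<in>I. a * x \<in> I\<rbrakk>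
      \<Longrightarrow> \<exists>g. I = {g * a | a. True}"

definition ring_embedding :: "('k::comm_ring_1 \<Rightarrow> 'r::comm_ring_1) \<Rightarrow> bool" where
  "ring_embedding h \<longleftrightarrow>
     h 1 = 1 \<and> (\<forall>x y. h (x + y) = h x + h y) \<and> (\<forall>x y. h (x * y) = h x * h y) \<and> inj h"

text \<open>
  The polynomial ring \<open>R[X1, X2]\<close> is modelled as \<open>R[X1][X2]\<close>, that is, as the type
  \<open>'r poly poly\<close>: the inner variable is \<open>X1\<close>, the outer variable is \<open>X2\<close>. A polynomial
  \<open>g \<in> R[X1]\<close> is the element \<open>[:g:]\<close> of this ring.
\<close>

definition scalar :: "'r::comm_ring_1 \<Rightarrow> 'r poly poly" where
  "scalar c = [:[:c:]:]"

definition X1 :: "'r::comm_ring_1 poly poly" where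
  "X1 = [:[:0, 1:]:]"

definition X2 :: "'r::comm_ring_1 poly poly" where
  "X2 = [:0, 1:]"

text \<open>
  In the next definition \<open>h :: 'r \<Rightarrow> 'b\<close> is the structure map of the \<open>R\<close>-algebra \<open>B\<close>.
\<close>

definition derivation_over :: "('r::comm_ring_1 \<Rightarrow> 'b::comm_ring_1) \<Rightarrow> ('b \<Rightarrow> 'b) \<Rightarrow> bool" where
  "derivation_over h D \<longleftrightarrow>
     (\<forall>x y. D (x + y) = D x + D y) \<and>
     (\<forall>c x. D (h c * x) = h c * D x) \<and>
     (\<forall>x y. D (x * y) = D x * y + x * D y)"

definition locally_nilpotent :: "('b::comm_ring_1 \<Rightarrow> 'b) \<Rightarrow> bool" where
  "locally_nilpotent D \<longleftrightarrow> (\<forall>b. \<exists>n. (D ^^ n) b = 0)"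

definition irreducible_derivation :: "('b::comm_ring_1 \<Rightarrow> 'b) \<Rightarrow> bool" where
  "irreducible_derivation D \<longleftrightarrow> \<not> (\<exists>b. \<not> b dvd 1 \<and> range D \<subseteq> {b * x | x. True})"

definition Ker :: "('b::comm_ring_1 \<Rightarrow> 'b) \<Rightarrow> 'b set" where
  "Ker D = {b. D b = 0}"

definition image_ideal :: "('b::comm_ring_1 \<Rightarrow> 'b) \<Rightarrow> nat \<Rightarrow> 'b set" where
  "image_ideal D j = Ker D \<inter> range (D ^^ j)"

text \<open>
  The subtraction below is truncated, which matters only for \<open>d = 0\<close>. The set whose minimum is
  taken is finite and nonempty for all \<open>d\<close> and \<open>j\<close>. In the theorem, \<open>d = 0\<close> means \<open>D X2 = 0\<close>;
  irreducibility then makes \<open>D X1\<close> a unit, so that \<open>D X1\<close> is the empty product \<open>1\<close> and the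
  exponent is irrelevant.
\<close>

definition min_exponent :: "nat \<Rightarrow> nat \<Rightarrow> nat" where
  "min_exponent d j = Min {i1 + (d - 1) * i2 | i1 i2. i1 + d * i2 = j}"

end

theory Submission
  imports Defs
begin

text \<open>
  Write \<open>a = D X1\<close> and \<open>F = a X2 + f(X1)\<close>. Then \<open>F\<close> is a constant of \<open>D\<close>, so \<open>D\<close> is linear over \<open>R[F]\<close>. The
  proof looks for families \<open>e\<^sub>0, e\<^sub>1, e\<^sub>2, ...\<close> in \<open>B\<close> for which \<open>D\<^sup>l e\<^sub>l\<close> is a nonzero constant
  of \<open>D\<close>, and whose \<open>R[F]\<close>-span contains a multiple \<open>s\<^sup>N y\<close> of every \<open>y\<close> (\<open>multiple_in_span\<close>). If
  \<open>\<alpha> = D\<^sup>j y\<close> is a constant, the expansion of \<open>s\<^sup>N y\<close> stops at \<open>e\<^sub>j\<close>, and \<open>s\<^sup>N \<alpha>\<close> is a multiple of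
  \<open>D\<^sup>j e\<^sub>j\<close> (\<open>leading_term\<close>).

  For the first image ideal put \<open>a = b c\<close>, where \<open>c\<close> collects the prime powers with index in \<open>J\<close>, and take
  \<open>e\<^sub>l = X1\<^sup>l\<close> and \<open>s = a\<close>. If \<open>D y\<close> is a constant, then \<open>a\<^sup>N y = g(F) X1 + h(F)\<close>, and \<open>X2 = 0\<close> gives
  \<open>g(f) X1 + h(f) \<equiv> 0\<close> modulo \<open>a\<^sup>N\<close> in \<open>R[X1]\<close>. Irreducibility of \<open>D\<close> excludes that some \<open>p\<^sub>i\<close> divides all
  coefficients of \<open>f\<close> of positive index; thus for \<open>i\<close> outside \<open>J\<close> the degree of \<open>f\<close> modulo \<open>p\<^sub>i\<close> is at
  least 2, and comparing degrees modulo \<open>p\<^sub>i\<close> forces \<open>p\<^sub>i\<close> to divide \<open>g\<close> and \<open>h\<close>. Repeating this, all of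
  \<open>b\<^sup>N\<close> divides \<open>g\<close>, whence \<open>b\<close> divides \<open>D y\<close> (\<open>image_ideal_one_dvd\<close>). For \<open>i\<close> in \<open>J\<close>, on the other hand, \<open>f\<close>
  is linear modulo \<open>p\<^sub>i\<close>, so \<open>f\<close> generates \<open>(R/c)[X1]\<close>; hence \<open>X1 = g(F) + c y\<close> for some \<open>g\<close> and \<open>y\<close>, and
  \<open>D y = b\<close> (\<open>image_ideal_one_mem\<close>).

  For the higher image ideals suppose that no \<open>p\<^sub>i\<close> divides \<open>f\<^sub>d\<close>. If \<open>d \<ge> 1\<close>, the monomials
  \<open>X1\<^sup>i X2\<^sup>k\<close> with \<open>i < d\<close> form a family as above for \<open>s = f\<^sub>d\<close>; \<open>i + d k\<close> derivatives turn such a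
  monomial into \<open>a\<^bsup>i + (d-1) k\<^esup>\<close> times a power of \<open>f\<^sub>d\<close>, up to sign and an integer. This yields one inclusion
  (\<open>image_ideal_dvd\<close>). The other one holds because \<open>a\<close> lies in the first image ideal, \<open>a\<^bsup>d-1\<^esup>\<close> lies in the
  \<open>d\<close>-th, and image ideals multiply (\<open>representation_mem\<close>). If \<open>d = 0\<close>, irreducibility makes the product
  \<open>a\<close> empty.
\<close>

section \<open>Comaximal elements and products of prime powers\<close>

text \<open>
  Bezout's identity is preserved by ring homomorphisms. It can therefore be established in the PID
  \<open>R\<close> and used in \<open>B\<close>, to cancel factors in divisibilities between polynomials.
\<close>

definition comaximal :: "'a::comm_ring_1 \<Rightarrow> 'a \<Rightarrow> bool" where
  "comaximal s t \<longleftrightarrow> (\<exists>u v. u * s + v * t = 1)"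

lemma comaximal_sym: "comaximal s t \<Longrightarrow> comaximal t s"
  unfolding comaximal_def by (metis add.commute)

lemma comaximal_one: "comaximal s 1"
  unfolding comaximal_def by (metis add.commute add_0_right mult_1 mult_zero_left)

lemma comaximal_mult:
  assumes "comaximal s t" "comaximal s t'"
  shows "comaximal s (t * t')"
proof -
  obtain u v u' v' where "u * s + v * t = 1" "u' * s + v' * t' = 1"
    using assms unfolding comaximal_def by blast
  then have "(u * s + v * t) * (u' * s + v' * t') = 1" by simp
  moreover have "(u * s + v * t) * (u' * s + v' * t')
      = (u * s * u' + u * v' * t' + v * t * u') * s + (v * v') * (t * t')"
    by (simp add: algebra_simps)
  ultimately show ?thesis unfolding comaximal_def by metis
qed

lemma comaximal_power: "comaximal s t \<Longrightarrow> comaximal s (t ^ n)"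
  by (induction n) (auto intro: comaximal_one comaximal_mult)

lemma comaximal_powers: "comaximal s t \<Longrightarrow> comaximal (s ^ m) (t ^ n)"
  by (meson comaximal_power comaximal_sym)

lemma comaximal_dvd_mult:
  assumes "comaximal s t" "t dvd s * x"
  shows "t dvd x"
proof -
  obtain u v where uv: "u * s + v * t = 1" using assms(1) unfolding comaximal_def by blast
  have "x = u * (s * x) + t * (v * x)"
    using arg_cong[OF uv, of "\<lambda>z. z * x"] by (simp add: algebra_simps)
  then show ?thesis using assms(2) by (metis dvd_add dvd_mult dvd_triv_left)
qed

text \<open>
  The ideal generated by \<open>s\<close> and \<open>p\<close> has a generator \<open>g\<close>; since \<open>g\<close> divides \<open>p\<close> and is not divisible
  by \<open>p\<close>, it is a unit.
\<close>

lemma comaximal_prime: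
  fixes p :: "'a::principal_ideal_domain"
  assumes p: "prime_elem p" and s: "\<not> p dvd s"
  shows "comaximal s p"
proof -
  let ?K = "{u * s + v * p | u v. True}"
  have "\<exists>g. ?K = {g * a | a. True}"
  proof (rule ideal_principal)
    have "0 = 0 * s + 0 * p" by simp
    then show "0 \<in> ?K" by blast
    show "\<forall>x\<in>?K. \<forall>y\<in>?K. x + y \<in> ?K"
    proof (clarify)
      fix u v u' v'
      have "u * s + v * p + (u' * s + v' * p) = (u + u') * s + (v + v') * p"
        by (simp add: algebra_simps)
      then show "\<exists>w z. u * s + v * p + (u' * s + v' * p) = w * s + z * p \<and> True" by blast
    qed
    show "\<forall>a. \<forall>x\<in>?K. a * x \<in> ?K"
    proof (clarify)
      fix a u v
      have "a * (u * s + v * p) = (a * u) * s + (a * v) * p"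
        by (simp add: algebra_simps)
      then show "\<exists>w z. a * (u * s + v * p) = w * s + z * p \<and> True" by blast
    qed
  qed
  then obtain g where g: "?K = {g * a | a. True}" by blast
  have "s = 1 * s + 0 * p" by simp
  then have "s \<in> ?K" by blast
  then have gs: "g dvd s" unfolding g by auto
  have "p = 0 * s + 1 * p" by simp
  then have "p \<in> ?K" by blast
  then obtain h where h: "p = g * h" unfolding g by auto
  have "\<not> p dvd g" using gs s dvd_trans by blast
  have "p dvd h" using prime_elem_dvd_multD[OF p, of g h] h \<open>\<not> p dvd g\<close> by auto
  then obtain w where "h = p * w" by (elim dvdE)
  with h have "p * 1 = p * (g * w)" by (simp add: ac_simps)
  then have "g * w = 1" using p by (metis mult_cancel_left prime_elem_def)
  then have "1 \<in> ?K" unfolding g by (metis (mono_tags, lifting) mem_Collect_eq)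
  then show ?thesis unfolding comaximal_def by (auto; metis)
qed

text \<open>
  Comaximality, and the two notions \<open>separates_content\<close> and \<open>generates_modulo\<close> introduced below, are
  all multiplicative. Checking them at single primes therefore settles them for \<open>D X1\<close> and its partial
  products, and it does not matter whether some of the listed primes are associated.
\<close>

lemma prod_power_closed:
  fixes p :: "'i \<Rightarrow> 'a::comm_monoid_mult"
  assumes one: "P 1" and mult: "\<And>x y. P x \<Longrightarrow> P y \<Longrightarrow> P (x * y)"
    and p: "\<And>i. i \<in> K \<Longrightarrow> P (p i)"
  shows "P (\<Prod>i\<in>K. p i ^ r i)"
proof -
  have pow: "P x \<Longrightarrow> P (x ^ m)" for x m
    by (induction m) (auto intro: one mult)
  show ?thesis using p
    by (induction K rule: infinite_finite_induct) (auto intro: one mult pow)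
qed

section \<open>Composition of polynomials modulo a prime\<close>

text \<open>
  Dropping the leading terms divisible by \<open>p\<close> yields a representative whose degree is the degree over
  \<open>R/p\<close>. This makes degree arguments over \<open>R/p\<close> possible without a type for the quotient ring.
\<close>

lemma reduced_modulo:
  fixes g :: "'a::idom poly"
  shows "\<exists>g1. [:p:] dvd g - g1 \<and> (g1 = 0 \<or> \<not> p dvd lead_coeff g1)"
proof (induction "degree g" arbitrary: g rule: less_induct)
  case less
  show ?case
  proof (cases "g = 0 \<or> \<not> p dvd lead_coeff g")
    case True
    then show ?thesis by (intro exI[of _ g]) auto
  next
    case False
    let ?m = "monom (lead_coeff g) (degree g)"
    have pm: "[:p:] dvd ?m" using False by (auto simp: const_poly_dvd_iff)
    show ?thesis
    proof (cases "degree g = 0")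
      case True
      then have "g = ?m" by (metis degree_eq_zeroE lead_coeff_pCons(2) monom_0)
      then show ?thesis using pm by (intro exI[of _ 0]) auto
    next
      case d: False
      have "degree (g - ?m) < degree g"
      proof -
        have "coeff (g - ?m) i = 0" if "i > degree g - 1" for i
          using that by (cases "i = degree g") (simp_all add: coeff_eq_0)
        then have "degree (g - ?m) \<le> degree g - 1" by (intro degree_le allI impI)
        then show ?thesis using d by simp
      qed
      then obtain g1 where "[:p:] dvd g - ?m - g1" "g1 = 0 \<or> \<not> p dvd lead_coeff g1"
        using less by blast
      moreover have "g - g1 = (g - ?m - g1) + ?m" by simp
      ultimately show ?thesis using pm by (metis dvd_add)
    qed
  qed
qed

lemma pcompose_diff_dvd:
  fixes f :: "'a::idom poly"
  assumes f: "[:p:] dvd f - f1" and g: "[:p:] dvd g - g1"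
  shows "[:p:] dvd pcompose g f - pcompose g1 f1"
proof -
  have "[:p:] dvd pcompose g f - pcompose g f1" for g
  proof (induction g)
    case (pCons c g)
    have "pcompose (pCons c g) f - pcompose (pCons c g) f1
      = (f - f1) * pcompose g f + f1 * (pcompose g f - pcompose g f1)"
      by (simp add: pcompose_pCons algebra_simps)
    then show ?case using pCons f by (metis dvd_add dvd_mult dvd_mult2)
  qed simp
  moreover from g obtain u where "g - g1 = smult p u" by (elim dvdE) auto
  then have "pcompose g f1 - pcompose g1 f1 = smult p (pcompose u f1)"
    by (metis pcompose_diff pcompose_smult)
  then have "[:p:] dvd pcompose g f1 - pcompose g1 f1" by (simp add: const_poly_dvd_iff)
  ultimately have "[:p:] dvd (pcompose g f - pcompose g f1) + (pcompose g f1 - pcompose g1 f1)"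
    by (rule dvd_add)
  then show ?thesis by simp
qed

text \<open>
  Let \<open>e \<ge> 2\<close> be the degree of \<open>f\<close> over \<open>R/p\<close>. Over \<open>R/p\<close>, the degrees
  of \<open>X g(f)\<close> and \<open>h(f)\<close>, if these are nonzero, are congruent to 1 and to 0 modulo \<open>e\<close>, so that their
  leading terms cannot cancel. For \<open>e = 1\<close> cancellation does happen; this is what distinguishes the indices in \<open>J\<close>.
\<close>

lemma dvd_separates_pcompose:
  fixes f g h :: "'a::idom poly"
  assumes p: "prime_elem p" and k: "k \<ge> 2" "\<not> p dvd coeff f k"
    and dvd: "[:p:] dvd [:0, 1:] * pcompose g f + pcompose h f"
  shows "[:p:] dvd g" "[:p:] dvd h"
proof -
  obtain f1 where f1: "[:p:] dvd f - f1" "f1 = 0 \<or> \<not> p dvd lead_coeff f1"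
    using reduced_modulo by blast
  obtain g1 where g1: "[:p:] dvd g - g1" "g1 = 0 \<or> \<not> p dvd lead_coeff g1"
    using reduced_modulo by blast
  obtain h1 where h1: "[:p:] dvd h - h1" "h1 = 0 \<or> \<not> p dvd lead_coeff h1"
    using reduced_modulo by blast
  have "\<not> p dvd coeff f1 k"
    using f1(1) k(2) by (metis const_poly_dvd_iff coeff_diff dvd_add diff_add_cancel)
  then have k1: "k \<le> degree f1" by (metis dvd_0_right le_degree)
  define e where "e = degree f1"
  have e: "e \<ge> 2" using k k1 e_def by linarith
  have lf: "\<not> p dvd lead_coeff f1" using f1(2) e e_def by auto
  have lc: "\<not> p dvd lead_coeff (pcompose w f1)" if "\<not> p dvd lead_coeff w" for w
    using that lf e p unfolding e_def
    by (subst lead_coeff_comp) (auto dest: prime_elem_dvd_multD prime_elem_dvd_power)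
  define u where "u = [:0, 1:] * pcompose g1 f1"
  define v where "v = pcompose h1 f1"
  have "[:p:] dvd [:0, 1:] * (pcompose g f - pcompose g1 f1) + (pcompose h f - pcompose h1 f1)"
    using pcompose_diff_dvd[OF f1(1) g1(1)] pcompose_diff_dvd[OF f1(1) h1(1)]
    by (metis dvd_add dvd_mult)
  moreover have "u + v = [:0, 1:] * pcompose g f + pcompose h f
      - ([:0, 1:] * (pcompose g f - pcompose g1 f1) + (pcompose h f - pcompose h1 f1))"
    by (simp add: u_def v_def algebra_simps)
  ultimately have uv: "[:p:] dvd u + v" using dvd dvd_diff by metis
  have dv: "degree v = degree h1 * e" by (simp add: v_def degree_pcompose e_def)
  have g10: "g1 = 0"
  proof (rule ccontr)
    assume ng: "g1 \<noteq> 0"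
    then have lg: "\<not> p dvd lead_coeff (pcompose g1 f1)" using g1(2) lc by blast
    then have "pcompose g1 f1 \<noteq> 0" by auto
    then have du: "degree u = Suc (degree g1 * e)"
      by (simp add: u_def degree_pcompose e_def)
    have lu: "\<not> p dvd lead_coeff u" using lg by (simp only: u_def lead_coeff_mult) simp
    have "Suc (degree g1 * e) mod e = 1" using e by (simp add: mod_Suc)
    then have "degree u \<noteq> degree v" using du dv e
      by (metis mod_mult_self2_is_0 zero_neq_one)
    then consider "degree u < degree v" | "degree v < degree u" by linarith
    then show False
    proof cases
      case 1
      then have "h1 \<noteq> 0" using dv by auto
      then have "\<not> p dvd lead_coeff v" using h1(2) lc v_def by blast
      moreover have "coeff (u + v) (degree v) = lead_coeff v" using 1 by (simp add: coeff_eq_0)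
      ultimately show False using uv by (metis const_poly_dvd_iff)
    next
      case 2
      then have "coeff (u + v) (degree u) = lead_coeff u" by (simp add: coeff_eq_0)
      then show False using uv lu by (metis const_poly_dvd_iff)
    qed
  qed
  then show "[:p:] dvd g" using g1(1) by simp
  have "u = 0" using g10 u_def by simp
  then have "[:p:] dvd v" using uv by simp
  then have "p dvd lead_coeff v" by (metis const_poly_dvd_iff)
  then have "h1 = 0" using h1(2) lc v_def by blast
  then show "[:p:] dvd h" using h1(1) by simp
qed

text \<open>
  For a nonzero \<open>q\<close> this says that \<open>f\<close> is transcendental over \<open>R/q\<close> and that 1 and \<open>X\<close> are linearly
  independent over \<open>(R/q)[f]\<close> in \<open>(R/q)[X]\<close>.
\<close>

definition separates_content :: "'a::idom poly \<Rightarrow> 'a \<Rightarrow> bool" where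
  "separates_content f q \<longleftrightarrow> q \<noteq> 0 \<and>
     (\<forall>g h. [:q:] dvd [:0, 1:] * pcompose g f + pcompose h f \<longrightarrow> [:q:] dvd g \<and> [:q:] dvd h)"

lemma separates_content_one: "separates_content f 1"
proof -
  have "[:1:] dvd (u::'a poly)" for u by (simp only: one_pCons[symmetric] one_dvd)
  then show ?thesis unfolding separates_content_def
    by (metis one_neq_zero)
qed

lemma separates_content_prime:
  assumes "prime_elem p" "k \<ge> 2" "\<not> p dvd coeff f k"
  shows "separates_content f p"
  using dvd_separates_pcompose[OF assms] prime_elem_not_zeroI[OF assms(1)]
  unfolding separates_content_def by blast

text \<open>
  After both coefficients are divided by \<open>q\<close>, the condition for \<open>q'\<close> applies to the quotients.
\<close>

lemma separates_content_mult:
  assumes q: "separates_content f q" and q': "separates_content f q'"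
  shows "separates_content f (q * q')"
  unfolding separates_content_def
proof (intro conjI allI impI)
  show "q * q' \<noteq> 0" using q q' by (simp add: separates_content_def)
  fix g h
  assume dvd: "[:q * q':] dvd [:0, 1:] * pcompose g f + pcompose h f"
  have split: "[:q * q':] = [:q:] * [:q':]" by simp
  have "[:q:] dvd [:0, 1:] * pcompose g f + pcompose h f"
    using dvd unfolding split by (rule dvd_mult_left)
  then have "[:q:] dvd g" "[:q:] dvd h" using q unfolding separates_content_def by blast+
  then obtain g1 h1 where gh: "g = smult q g1" "h = smult q h1" by (auto elim!: dvdE)
  have "[:0, 1:] * pcompose g f + pcompose h f
      = [:q:] * ([:0, 1:] * pcompose g1 f + pcompose h1 f)"
    by (simp add: gh pcompose_smult smult_add_right)
  then have "[:q':] dvd [:0, 1:] * pcompose g1 f + pcompose h1 f"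
    using dvd q unfolding split separates_content_def
    by (simp only: dvd_mult_cancel_left pCons_eq_0_iff) simp
  then have "[:q':] dvd g1" "[:q':] dvd h1" using q' unfolding separates_content_def by blast+
  moreover have "g = [:q:] * g1" "h = [:q:] * h1" using gh by simp_all
  ultimately show "[:q * q':] dvd g" "[:q * q':] dvd h"
    unfolding split by (simp_all only: mult_dvd_mono dvd_refl)
qed

lemma separates_content_power: "separates_content f q \<Longrightarrow> separates_content f (q ^ n)"
  by (induction n) (auto intro: separates_content_one separates_content_mult)

text \<open>
  This says \<open>R[X] = R[f] + c R[X]\<close>, that is, \<open>f\<close> generates \<open>(R/c)[X]\<close> as an \<open>R\<close>-algebra.
\<close>

definition generates_modulo :: "'a::comm_ring_1 poly \<Rightarrow> 'a \<Rightarrow> bool" where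
  "generates_modulo f c \<longleftrightarrow> (\<forall>u. \<exists>g v. u = pcompose g f + smult c v)"

lemma generates_modulo_one: "generates_modulo f 1"
  unfolding generates_modulo_def by (metis add_0 pcompose_0 smult_1_left)

text \<open>
  Substituting one decomposition into the other lifts \<open>f\<close> as a generator from \<open>R/c\<close> and \<open>R/c'\<close> to
  \<open>R/cc'\<close>; in particular this passes from a prime to its powers.
\<close>

lemma generates_modulo_mult:
  fixes f :: "'a::comm_ring_1 poly"
  assumes "generates_modulo f c" "generates_modulo f c'"
  shows "generates_modulo f (c * c')"
  unfolding generates_modulo_def
proof
  fix u
  obtain g v where u: "u = pcompose g f + smult c v"
    using assms(1) unfolding generates_modulo_def by blast
  obtain g' v' where v: "v = pcompose g' f + smult c' v'"
    using assms(2) unfolding generates_modulo_def by blast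
  have "u = pcompose (g + smult c g') f + smult (c * c') v'"
    by (simp add: u v pcompose_add pcompose_smult smult_add_right)
  then show "\<exists>g v. u = pcompose g f + smult (c * c') v" by blast
qed

text \<open>
  Modulo \<open>p\<close> the polynomial \<open>f\<close> is linear with invertible leading coefficient, so \<open>X\<close> itself is a
  polynomial in \<open>f\<close>; and \<open>R[f] + p R[X]\<close> is a subring.
\<close>

lemma generates_modulo_linear:
  fixes f :: "'a::idom poly"
  assumes co: "comaximal (coeff f 1) p" and dvd: "\<And>j. j \<ge> 2 \<Longrightarrow> p dvd coeff f j"
  shows "generates_modulo f p"
proof -
  obtain s t where st: "s * coeff f 1 + t * p = 1" using co unfolding comaximal_def by blast
  have "p dvd coeff (f - [:coeff f 0, coeff f 1:]) j" for j
    using dvd[of j] by (cases "j \<in> {0, 1}") (auto simp: coeff_pCons split: nat.splits)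
  then have "[:p:] dvd f - [:coeff f 0, coeff f 1:]"
    by (simp only: const_poly_dvd_iff) blast
  then obtain w where w: "f - [:coeff f 0, coeff f 1:] = [:p:] * w" by (elim dvdE)
  \<comment> \<open>Here s is an inverse of the linear coefficient modulo p, so X = s (f - f_0) modulo p.\<close>
  have X: "[:0, 1:] = pcompose [:- s * coeff f 0, s:] f + smult p ([:0, t:] - smult s w)"
  proof -
    have "f = [:coeff f 0, coeff f 1:] + smult p w" using w by (simp add: algebra_simps)
    then have "pcompose [:- s * coeff f 0, s:] f
        = [:- s * coeff f 0:] + smult s ([:coeff f 0, coeff f 1:] + smult p w)"
      by (simp add: pcompose_pCons)
    also have "\<dots> = [:0, s * coeff f 1:] + smult p (smult s w)"
      by (simp add: smult_add_right mult.commute)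
    finally show ?thesis using st by (simp add: smult_diff_right mult.commute)
  qed
  define g0 where "g0 = [:- s * coeff f 0, s:]"
  define v0 where "v0 = [:0, t:] - smult s w"
  have X': "[:0, 1:] = pcompose g0 f + smult p v0" using X unfolding g0_def v0_def .
  have "\<exists>g v. u = pcompose g f + smult p v" for u
  proof (induction u)
    case 0
    show ?case by (intro exI[of _ 0]) simp
  next
    case (pCons c u)
    then obtain g v where u: "u = pcompose g f + smult p v" by blast
    have "pCons c u = [:c:] + [:0, 1:] * u" by simp
    also have "\<dots> = [:c:] + [:0, 1:] * (pcompose g f) + [:0, 1:] * smult p v"
      by (subst u) (simp only: distrib_left add.assoc)
    also have "\<dots> = pcompose ([:c:] + g0 * g) f + smult p (v0 * pcompose g f + [:0, 1:] * v)"
      by (subst X') (simp add: pcompose_add pcompose_mult algebra_simps smult_add_right)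
    finally show ?case by blast
  qed
  then show ?thesis unfolding generates_modulo_def by blast
qed

section \<open>Derivations of the polynomial ring in two variables\<close>

lemma of_nat_dvd_one:
  fixes \<iota> :: "'k::field_char_0 \<Rightarrow> 'r::comm_ring_1"
  assumes "ring_embedding \<iota>" "m > 0"
  shows "(of_nat m :: 'r) dvd 1"
proof -
  have h: "\<iota> 1 = 1" "\<iota> (x + y) = \<iota> x + \<iota> y" "\<iota> (x * y) = \<iota> x * \<iota> y" for x y
    using assms(1) unfolding ring_embedding_def by auto
  have "\<iota> 0 = 0" using h(2)[of 0 0] by simp
  then have "\<iota> (of_nat l) = of_nat l" for l by (induction l) (simp_all add: h)
  then have "of_nat m * \<iota> (1 / of_nat m) = 1"
    using h assms(2) by (metis nonzero_mult_div_cancel_left of_nat_eq_0_iff less_numeral_extra(3) times_divide_eq_right mult.right_neutral)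
  then show ?thesis by (metis dvd_triv_left)
qed

lemma scalar_hom:
  "scalar 0 = 0" "scalar 1 = 1" "scalar (x + y) = scalar x + scalar y"
  "scalar (x * y) = scalar x * scalar y" "scalar (- x) = - scalar x"
  by (simp_all add: scalar_def one_pCons)

lemma scalar_power: "scalar (x ^ n) = scalar x ^ n"
  by (induction n) (simp_all add: scalar_hom)

lemmas scalar_simps = scalar_hom scalar_power

lemma scalar_of_nat: "scalar (of_nat m) = of_nat m"
  by (induction m) (simp_all add: scalar_simps)

lemma scalar_eq_0_iff: "scalar c = 0 \<longleftrightarrow> c = 0"
  by (simp add: scalar_def)

lemma scalar_dvd: "x dvd y \<Longrightarrow> scalar x dvd scalar y"
  by (auto elim!: dvdE simp: scalar_simps)

lemma comaximal_scalar: "comaximal s t \<Longrightarrow> comaximal (scalar s) (scalar t)"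
  unfolding comaximal_def by (metis scalar_simps(2,3,4))

lemma poly_poly_induct:
  fixes P :: "'r::comm_ring_1 poly poly \<Rightarrow> bool"
  assumes scalar: "\<And>c. P (scalar c)" and P1: "P X1" and P2: "P X2"
    and add: "\<And>x y. P x \<Longrightarrow> P y \<Longrightarrow> P (x + y)" and mult: "\<And>x y. P x \<Longrightarrow> P y \<Longrightarrow> P (x * y)"
  shows "P z"
proof -
  have zero: "P 0" using scalar[of 0] by (simp add: scalar_simps)
  have inner: "P [:g:]" for g
  proof (induction g)
    case (pCons c g)
    have "[:pCons c g:] = scalar c + X1 * [:g:]" by (simp add: scalar_def X1_def)
    then show ?case using pCons by (metis add mult scalar P1)
  qed (simp add: zero)
  show ?thesis
  proof (induction z)
    case (pCons g z)
    have "pCons g z = [:g:] + X2 * z" by (simp add: X2_def)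
    then show ?case using pCons by (metis add mult inner P2)
  qed (rule zero)
qed

text \<open>
  The conditions on \<open>a\<close> and \<open>f\<close> under which image ideals are determined below are expressed by
  \<open>comaximal\<close>, \<open>separates_content\<close> and \<open>generates_modulo\<close>. Positive integers are to be invertible because
  iterating \<open>D\<close> produces factorials and binomial coefficients.
\<close>

locale triangular_derivation =
  fixes D :: "'r::idom poly poly \<Rightarrow> 'r poly poly" and a :: 'r and f :: "'r poly"
  assumes derivation: "derivation_over scalar D"
    and D_X1: "D X1 = scalar a"
    and D_X2: "D X2 = - [:pderiv f:]"
    and a_nonzero: "a \<noteq> 0"
    and of_nat_unit: "\<And>m. m > 0 \<Longrightarrow> (of_nat m :: 'r) dvd 1"
begin

lemma D_add: "D (x + y) = D x + D y"
  and D_scalar_mult: "D (scalar c * x) = scalar c * D x"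
  and D_mult: "D (x * y) = D x * y + x * D y"
  using derivation unfolding derivation_over_def by blast+

lemma D_0: "D 0 = 0"
  by (metis D_add add_0 add_cancel_left_left)

lemma D_1: "D 1 = 0"
  by (metis D_mult mult_1 mult.right_neutral add_cancel_left_left)

lemma D_scalar: "D (scalar c) = 0"
  using D_scalar_mult[of c 1] by (simp add: D_1)

lemma D_minus: "D (- x) = - D x"
  using D_add[of x "- x"] by (simp add: D_0 eq_neg_iff_add_eq_0 add.commute)

lemma Dn_add: "(D ^^ n) (x + y) = (D ^^ n) x + (D ^^ n) y"
  by (induction n) (simp_all add: D_add)

lemma Dn_minus: "(D ^^ n) (- x) = - (D ^^ n) x"
  by (induction n) (simp_all add: D_minus)

lemma Dn_0: "(D ^^ n) 0 = 0"
  by (induction n) (simp_all add: D_0)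

lemma Dn_Ker_mult: "D c = 0 \<Longrightarrow> (D ^^ n) (c * x) = c * (D ^^ n) x"
  by (induction n) (simp_all add: D_mult)

lemma Dn_eq_0: "(D ^^ m) x = 0 \<Longrightarrow> m \<le> n \<Longrightarrow> (D ^^ n) x = 0"
  by (metis Dn_0 add_diff_cancel_left' comp_apply funpow_add le_add_diff_inverse2)

lemma image_ideal_iff: "\<alpha> \<in> image_ideal D j \<longleftrightarrow> D \<alpha> = 0 \<and> (\<exists>y. (D ^^ j) y = \<alpha>)"
  by (auto simp: image_ideal_def Ker_def)

lemma image_ideal_add:
  "\<alpha> \<in> image_ideal D j \<Longrightarrow> \<beta> \<in> image_ideal D j \<Longrightarrow> \<alpha> + \<beta> \<in> image_ideal D j"
  unfolding image_ideal_iff by (auto simp: D_add simp flip: Dn_add)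

lemma image_ideal_Ker_mult:
  "c \<in> Ker D \<Longrightarrow> \<alpha> \<in> image_ideal D j \<Longrightarrow> c * \<alpha> \<in> image_ideal D j"
  unfolding image_ideal_iff Ker_def by (auto simp: D_mult simp flip: Dn_Ker_mult)

lemma Ker_dvd: "c \<noteq> 0 \<Longrightarrow> D c = 0 \<Longrightarrow> D (c * x) = 0 \<Longrightarrow> D x = 0"
  by (simp add: D_mult)

text \<open>
  If \<open>c \<noteq> 0\<close> and \<open>c x\<close> are constants of \<open>D\<close>, then so is \<open>x\<close>. Hence an element of an image ideal generates it as soon as it divides all its members in \<open>B\<close>.
\<close>

lemma image_ideal_eq:
  assumes c: "c \<noteq> 0" "c \<in> image_ideal D j" and dvd: "\<And>\<alpha>. \<alpha> \<in> image_ideal D j \<Longrightarrow> c dvd \<alpha>"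
  shows "image_ideal D j = {c * x | x. x \<in> Ker D}"
proof safe
  fix \<alpha> assume \<alpha>: "\<alpha> \<in> image_ideal D j"
  then obtain x where x: "\<alpha> = c * x" using dvd by (auto elim: dvdE)
  moreover have "D x = 0"
    using Ker_dvd[OF c(1), of x] c(2) \<alpha> x unfolding image_ideal_iff by auto
  ultimately show "\<exists>x. \<alpha> = c * x \<and> x \<in> Ker D" by (auto simp: Ker_def)
next
  fix x assume "x \<in> Ker D"
  then show "c * x \<in> image_ideal D j"
    using image_ideal_Ker_mult[OF _ c(2), of x] by (simp add: mult.commute)
qed

text \<open>
  Up to a positive integer, \<open>\<alpha>\<close> is the top nonzero iterated derivative of \<open>y\<close> (if \<open>\<alpha> \<noteq> 0\<close>). Leaving the
  integer factor unspecified makes the notion multiplicative without recording binomial coefficients.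
\<close>

definition leads :: "nat \<Rightarrow> 'r poly poly \<Rightarrow> 'r poly poly \<Rightarrow> bool" where
  "leads j y \<alpha> \<longleftrightarrow> D \<alpha> = 0 \<and> (\<exists>m>0. (D ^^ j) y = of_nat m * \<alpha>)"

lemma D_of_nat: "D (of_nat m) = 0"
  by (metis D_scalar scalar_of_nat)

text \<open>
  In the Leibniz formula for the \<open>(i + j)\<close>-th derivative of \<open>u v\<close> only the term with \<open>i\<close> derivatives on
  \<open>u\<close> survives. The induction needs just Pascal's rule.
\<close>

lemma Dn_mult_leading:
  assumes "D \<alpha> = 0" "D \<beta> = 0" "(D ^^ i) u = \<alpha>" "(D ^^ j) v = \<beta>"
  shows "(D ^^ (i + j)) (u * v) = of_nat ((i + j) choose i) * (\<alpha> * \<beta>)"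
  using assms(3,4)
proof (induction "i + j" arbitrary: i j u v)
  case 0
  then show ?case by simp
next
  case (Suc n)
  show ?case
  proof (cases i)
    case 0
    then show ?thesis using Suc assms by (simp add: Dn_Ker_mult)
  next
    case i: (Suc i')
    show ?thesis
    proof (cases j)
      case 0
      then show ?thesis using Suc assms Dn_Ker_mult[of v i u] by (simp add: mult.commute)
    next
      case j: (Suc j')
      have "(D ^^ (i' + j)) (D u * v) = of_nat ((i' + j) choose i') * (\<alpha> * \<beta>)"
        using Suc i j by (intro Suc(1)) (simp_all add: funpow_swap1)
      moreover have "(D ^^ (i + j')) (u * D v) = of_nat ((i + j') choose i) * (\<alpha> * \<beta>)"
        using Suc i j by (intro Suc(1)) (simp_all add: funpow_swap1)
      moreover have "(D ^^ (i + j)) (u * v) = (D ^^ (i' + j)) (D u * v) + (D ^^ (i + j')) (u * D v)"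
      proof -
        have "i + j = Suc (i' + j)" "i + j' = i' + j" using i j by simp_all
        then show ?thesis by (simp only: funpow_Suc_right comp_apply D_mult Dn_add)
      qed
      ultimately show ?thesis
        using i j by (simp add: algebra_simps)
    qed
  qed
qed

lemma leads_mult:
  assumes "leads i u \<alpha>" "leads j v \<beta>"
  shows "leads (i + j) (u * v) (\<alpha> * \<beta>)"
proof -
  obtain m m' where m: "m > 0" "(D ^^ i) u = of_nat m * \<alpha>" "m' > 0" "(D ^^ j) v = of_nat m' * \<beta>"
    using assms unfolding leads_def by auto
  have D: "D \<alpha> = 0" "D \<beta> = 0" using assms unfolding leads_def by auto
  have "(D ^^ (i + j)) (u * v) = of_nat ((i + j) choose i) * ((of_nat m * \<alpha>) * (of_nat m' * \<beta>))"
    using D m by (intro Dn_mult_leading) (simp_all add: D_mult D_of_nat)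
  also have "\<dots> = of_nat (((i + j) choose i) * m * m') * (\<alpha> * \<beta>)"
    by (simp add: algebra_simps)
  finally have "(D ^^ (i + j)) (u * v) = of_nat (((i + j) choose i) * m * m') * (\<alpha> * \<beta>)" .
  moreover have "((i + j) choose i) * m * m' > 0" using m by simp
  ultimately show ?thesis using D unfolding leads_def by (metis D_mult add_0 mult_zero_left mult_zero_right)
qed

lemma leads_power: "leads i u \<alpha> \<Longrightarrow> leads (i * k) (u ^ k) (\<alpha> ^ k)"
proof (induction k)
  case 0
  show ?case unfolding leads_def by (auto simp: D_1 intro!: exI[of _ 1])
next
  case (Suc k)
  then show ?case using leads_mult[of i u \<alpha> "i * k" "u ^ k" "\<alpha> ^ k"] by simp
qed

lemma of_nat_nonzero: "m > 0 \<Longrightarrow> (of_nat m :: 'r poly poly) \<noteq> 0"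
  using of_nat_unit[of m] by (auto simp flip: scalar_of_nat simp: scalar_eq_0_iff)

lemma leads_nonzero: "leads j y \<alpha> \<Longrightarrow> \<alpha> \<noteq> 0 \<Longrightarrow> (D ^^ j) y \<noteq> 0 \<and> D ((D ^^ j) y) = 0"
  unfolding leads_def by (auto simp: of_nat_nonzero D_mult D_of_nat)

lemma leads_image_ideal: "leads j y \<alpha> \<Longrightarrow> \<alpha> \<in> image_ideal D j"
proof -
  assume "leads j y \<alpha>"
  then obtain m where m: "m > 0" "(D ^^ j) y = of_nat m * \<alpha>" and D: "D \<alpha> = 0"
    unfolding leads_def by blast
  obtain w where w: "of_nat m * w = (1::'r)" using of_nat_unit[OF m(1)] by (metis dvdE)
  have "(D ^^ j) (scalar w * y) = scalar w * (of_nat m * \<alpha>)"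
    by (simp only: Dn_Ker_mult[OF D_scalar] m(2))
  also have "\<dots> = scalar (of_nat m * w) * \<alpha>"
    by (simp add: scalar_simps scalar_of_nat ac_simps)
  finally have "(D ^^ j) (scalar w * y) = scalar (of_nat m * w) * \<alpha>" .
  then show ?thesis unfolding image_ideal_iff using D w by (auto simp: scalar_simps)
qed

lemma image_ideal_leads: "\<alpha> \<in> image_ideal D j \<Longrightarrow> \<exists>y. leads j y \<alpha>"
  unfolding image_ideal_iff leads_def by (metis less_numeral_extra(1) mult_1 of_nat_1)

lemma image_ideal_mult:
  "\<alpha> \<in> image_ideal D i \<Longrightarrow> \<beta> \<in> image_ideal D j \<Longrightarrow> \<alpha> * \<beta> \<in> image_ideal D (i + j)"
  by (meson image_ideal_leads leads_image_ideal leads_mult)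

lemma image_ideal_power: "\<alpha> \<in> image_ideal D i \<Longrightarrow> \<alpha> ^ k \<in> image_ideal D (i * k)"
  by (meson image_ideal_leads leads_image_ideal leads_power)

lemma leads_X1: "leads 1 X1 (scalar a)"
  unfolding leads_def by (auto simp: D_scalar D_X1 intro!: exI[of _ 1])

lemma D_inner: "D [:g:] = [:smult a (pderiv g):]"
proof (induction g)
  case 0
  show ?case by (simp add: D_0)
next
  case (pCons c g)
  have "[:pCons c g:] = scalar c + X1 * [:g:]" by (simp add: scalar_def X1_def)
  then have "D [:pCons c g:] = scalar a * [:g:] + X1 * [:smult a (pderiv g):]"
    using pCons(2) by (simp only: D_add D_scalar D_mult D_X1 add_0)
  then show ?case by (simp add: pderiv_pCons scalar_def X1_def smult_add_right)
qed

lemma Dn_inner: "(D ^^ n) [:g:] = [:smult (a ^ n) ((pderiv ^^ n) g):]"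
  by (induction n) (simp_all add: D_inner pderiv_smult)

lemma higher_pderiv_degree:
  "(pderiv ^^ degree f) f = [:of_nat (fact (degree f)) * lead_coeff f:]"
proof (rule poly_eqI)
  fix k
  show "coeff ((pderiv ^^ degree f) f) k = coeff [:of_nat (fact (degree f)) * lead_coeff f:] k"
    using pochhammer_of_nat[of 1 "degree f", where ?'a = 'r]
    by (cases k) (simp_all add: coeff_higher_pderiv coeff_eq_0 pochhammer_fact)
qed

text \<open>
  The first derivative of \<open>X2\<close> is the polynomial \<open>-f'(X1)\<close>, and on \<open>R[X1]\<close> the derivation \<open>D\<close> acts as
  \<open>a\<close> times the usual one. The \<open>d\<close>-th derivative therefore is \<open>-d! f\<^sub>d a\<^bsup>d-1\<^esup>\<close> for \<open>d = deg f\<close>.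
\<close>

lemma leads_X2:
  assumes "degree f > 0"
  shows "leads (degree f) X2 (- scalar (lead_coeff f * a ^ (degree f - 1)))"
proof -
  obtain n where n: "degree f = Suc n" using assms by (metis gr0_conv_Suc)
  have "(D ^^ Suc n) X2 = (D ^^ n) (- [:pderiv f:])"
    by (simp add: funpow_Suc_right D_X2 del: funpow.simps)
  also have "\<dots> = - [:smult (a ^ n) ((pderiv ^^ n) (pderiv f)):]"
    by (simp only: Dn_minus Dn_inner)
  also have "(pderiv ^^ n) (pderiv f) = (pderiv ^^ degree f) f"
    by (simp add: n funpow_Suc_right del: funpow.simps)
  also have "\<dots> = [:of_nat (fact (degree f)) * lead_coeff f:]" by (rule higher_pderiv_degree)
  also have "- [:smult (a ^ n) [:of_nat (fact (degree f)) * lead_coeff f:]:]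
      = of_nat (fact (degree f)) * (- scalar (lead_coeff f * a ^ n))"
    by (simp add: scalar_def of_nat_poly ac_simps)
  finally show ?thesis unfolding leads_def using n
    by (auto simp: D_minus D_scalar intro!: exI[of _ "fact (degree f)"])
qed

section \<open>The module structure over the constants generated by F\<close>

text \<open>
  The basic constant of \<open>D\<close>: its derivative is \<open>-a f'(X1) + f'(X1) a = 0\<close>.
\<close>

definition F :: "'r poly poly" where
  "F = scalar a * X2 + [:f:]"

definition at_F :: "'r poly \<Rightarrow> 'r poly poly" where
  "at_F g = poly (map_poly scalar g) F"

lemma at_F_0: "at_F 0 = 0"
  by (simp add: at_F_def)

lemma at_F_pCons: "at_F (pCons c g) = scalar c + F * at_F g"
  by (simp add: at_F_def map_poly_pCons scalar_simps)

lemma at_F_const: "at_F [:c:] = scalar c"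
  by (simp add: at_F_pCons at_F_0)

lemma at_F_add: "at_F (g + h) = at_F g + at_F h"
  by (induction g h rule: poly_induct2) (simp_all add: at_F_0 at_F_pCons scalar_simps algebra_simps)

lemma at_F_smult: "at_F (smult c g) = scalar c * at_F g"
  by (induction g) (simp_all add: at_F_0 at_F_pCons scalar_simps algebra_simps)

lemma at_F_mult: "at_F (g * h) = at_F g * at_F h"
  by (induction g) (simp_all add: at_F_0 at_F_pCons at_F_add at_F_smult scalar_simps algebra_simps)

lemma D_F: "D F = 0"
  by (simp add: F_def D_add D_mult D_scalar D_X2 D_inner) (simp add: scalar_def)

lemma D_at_F: "D (at_F g) = 0"
  by (induction g) (simp_all add: at_F_0 D_0 at_F_pCons D_add D_scalar D_mult D_F)

lemma poly_at_F_0: "poly (at_F g) 0 = pcompose g f"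
  by (induction g) (simp_all add: at_F_0 at_F_pCons pcompose_pCons scalar_def F_def X2_def)

lemma at_F_pcompose_dvd: "scalar a dvd at_F g - [:pcompose g f:]"
proof (induction g)
  case (pCons c g)
  have "at_F (pCons c g) - [:pcompose (pCons c g) f:]
      = (F - [:f:]) * at_F g + [:f:] * (at_F g - [:pcompose g f:])"
    by (simp add: at_F_pCons pcompose_pCons scalar_def algebra_simps)
  moreover have "scalar a dvd F - [:f:]" by (simp add: F_def)
  ultimately show ?case using pCons by (metis dvd_add dvd_mult dvd_mult2)
qed (simp add: at_F_0)

text \<open>
  With this scalar multiplication \<open>B\<close> is a module over \<open>R[T]\<close> on which \<open>T\<close> acts as \<open>F\<close>. The
  elements \<open>at_F g\<close> are constants of \<open>D\<close>, so \<open>D\<close> is linear for this structure.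
\<close>

definition scale_F :: "'r poly \<Rightarrow> 'r poly poly \<Rightarrow> 'r poly poly" where
  "scale_F g y = at_F g * y"

interpretation F: module scale_F
  by unfold_locales
    (simp_all add: scale_F_def at_F_add at_F_mult at_F_const[of 1, folded one_pCons]
      scalar_simps algebra_simps)

lemma span_scalar: "y \<in> F.span S \<Longrightarrow> scalar c * y \<in> F.span S"
  using F.span_scale[of y S "[:c:]"] by (simp add: scale_F_def at_F_const)

lemma span_F: "y \<in> F.span S \<Longrightarrow> F * y \<in> F.span S"
  using F.span_scale[of y S "[:0, 1:]"]
  by (simp add: scale_F_def at_F_pCons at_F_0 scalar_simps)

lemma span_mult_generators:
  assumes "\<And>e. e \<in> S \<Longrightarrow> z * e \<in> F.span S" "y \<in> F.span S"
  shows "z * y \<in> F.span S"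
  using assms(2)
proof (induction y rule: F.span_induct_alt)
  case base
  show ?case by (simp add: F.span_zero)
next
  case (step c x y)
  have "z * (scale_F c x + y) = scale_F c (z * x) + z * y"
    by (simp add: scale_F_def algebra_simps)
  then show ?case using step assms(1) by (simp add: F.span_add F.span_scale)
qed

text \<open>
  If \<open>s X1\<close> and \<open>s X2\<close> map the span into itself, then the elements of \<open>B\<close> with a multiple \<open>s\<^sup>N y\<close> in the
  span are stable under multiplication by \<open>X1\<close> and by \<open>X2\<close>. They contain 1, so they exhaust \<open>B\<close>.
  In other words, the span becomes everything after localization at \<open>s\<close>.
\<close>

lemma multiple_in_span:
  assumes one: "1 \<in> F.span S"
    and e1: "\<And>e. e \<in> S \<Longrightarrow> scalar s * X1 * e \<in> F.span S"
    and e2: "\<And>e. e \<in> S \<Longrightarrow> scalar s * X2 * e \<in> F.span S"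
  shows "\<exists>N. scalar (s ^ N) * y \<in> F.span S"
proof -
  let ?M = "{y. \<exists>N. scalar (s ^ N) * y \<in> F.span S}"
  have mono: "scalar (s ^ N') * y \<in> F.span S" if "scalar (s ^ N) * y \<in> F.span S" "N \<le> N'" for y N N'
  proof -
    have "s ^ N' = s ^ (N' - N) * s ^ N" using that(2) by (simp flip: power_add)
    then show ?thesis using span_scalar[OF that(1), of "s ^ (N' - N)"]
      by (simp add: scalar_hom mult.assoc)
  qed
  have gen: "z * y \<in> ?M" if z: "\<And>e. e \<in> S \<Longrightarrow> scalar s * z * e \<in> F.span S" and y: "y \<in> ?M" for y z
  proof -
    obtain N where "scalar (s ^ N) * y \<in> F.span S" using y by blast
    then have "scalar s * z * (scalar (s ^ N) * y) \<in> F.span S"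
      by (rule span_mult_generators[rotated]) (rule z)
    moreover have "scalar s * z * (scalar (s ^ N) * y) = scalar (s ^ Suc N) * (z * y)"
      by (simp add: scalar_hom ac_simps)
    ultimately have "scalar (s ^ Suc N) * (z * y) \<in> F.span S" by (simp only:)
    then show ?thesis by blast
  qed
  have "\<forall>y\<in>?M. z * y \<in> ?M" for z
  proof (induction z rule: poly_poly_induct)
    case (1 c)
    show ?case
    proof safe
      fix y N assume "scalar (s ^ N) * y \<in> F.span S"
      from span_scalar[OF this, of c] show "\<exists>N. scalar (s ^ N) * (scalar c * y) \<in> F.span S"
        by (intro exI[of _ N]) (simp add: mult.left_commute)
    qed
  next
    case 2
    show ?case using gen e1 by blast
  next
    case 3
    show ?case using gen e2 by blast
  next
    case (4 z z')
    show ?case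
    proof
      fix y assume y: "y \<in> ?M"
      obtain N N' where N: "scalar (s ^ N) * (z * y) \<in> F.span S" "scalar (s ^ N') * (z' * y) \<in> F.span S"
        using 4 y by blast
      have "scalar (s ^ max N N') * (z * y) \<in> F.span S" "scalar (s ^ max N N') * (z' * y) \<in> F.span S"
        using mono[OF N(1), of "max N N'"] mono[OF N(2), of "max N N'"] by simp_all
      then have "scalar (s ^ max N N') * ((z + z') * y) \<in> F.span S"
        by (simp only: distrib_right distrib_left F.span_add)
      then show "(z + z') * y \<in> ?M" by blast
    qed
  next
    case (5 z z')
    then show ?case by (simp only: mult.assoc) blast
  qed
  moreover have "1 \<in> ?M" using one by (auto intro!: exI[of _ 0] simp: scalar_simps)
  ultimately have "y * 1 \<in> ?M" by blast
  then show ?thesis by simp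
qed

text \<open>
  The family \<open>e\<close> is triangular with respect to \<open>D\<close>: exactly \<open>l\<close> derivatives turn \<open>e l\<close> into a nonzero
  constant. If \<open>D\<^bsup>j+1\<^esup> y = 0\<close>, then applying \<open>D\<^sup>l\<close> for the largest index \<open>l > j\<close> in an expansion of \<open>y\<close>
  shows that the corresponding coefficient vanishes, and so on down to the index \<open>j\<close>.
\<close>

lemma leading_term:
  assumes e: "\<And>l. (D ^^ l) (e l) \<noteq> 0 \<and> D ((D ^^ l) (e l)) = 0"
    and y: "y \<in> F.span (range e)" and zero: "(D ^^ Suc j) y = 0"
  shows "\<exists>g. y - at_F g * e j \<in> F.span (e ` {..<j}) \<and> (D ^^ j) y = at_F g * (D ^^ j) (e j)"
proof -
  have kill: "(D ^^ L) u = 0" if "u \<in> F.span (e ` {..<L})" for L u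
    using that
  proof (induction u rule: F.span_induct_alt)
    case base
    show ?case by (rule Dn_0)
  next
    case (step c x u)
    then obtain l where l: "x = e l" "l < L" by blast
    have "(D ^^ Suc l) (e l) = 0" using e[of l] by simp
    then have "(D ^^ L) x = 0" using l Dn_eq_0 Suc_leI by blast
    then show ?case using step by (simp add: Dn_add scale_F_def Dn_Ker_mult D_at_F)
  qed
  have split: "\<exists>g. u - at_F g * e L \<in> F.span (e ` {..<L}) \<and> (D ^^ L) u = at_F g * (D ^^ L) (e L)"
    if "u \<in> F.span (e ` {..<Suc L})" for L u
  proof -
    have "u \<in> F.span (insert (e L) (e ` {..<L}))" using that by (simp add: lessThan_Suc)
    then obtain g where g: "u - at_F g * e L \<in> F.span (e ` {..<L})"
      unfolding F.span_breakdown_eq scale_F_def by blast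
    have "(D ^^ L) u = (D ^^ L) (u - at_F g * e L) + (D ^^ L) (at_F g * e L)"
      by (simp flip: Dn_add)
    then show ?thesis using g kill[OF g] by (auto simp: Dn_Ker_mult D_at_F)
  qed
  have "\<exists>L. y \<in> F.span (e ` {..<L})"
    using y
  proof (induction y rule: F.span_induct_alt)
    case base
    show ?case by (auto intro: F.span_zero)
  next
    case (step c x y)
    then obtain l L where l: "x = e l" "y \<in> F.span (e ` {..<L})" by blast
    have "x \<in> F.span (e ` {..<max (Suc l) L})" using l by (auto intro!: F.span_base)
    moreover have "e ` {..<L} \<subseteq> e ` {..<max (Suc l) L}" by auto
    then have "y \<in> F.span (e ` {..<max (Suc l) L})" using l(2) F.span_mono by blast
    ultimately show ?case using F.span_add F.span_scale by blast
  qed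
  then obtain L where "y \<in> F.span (e ` {..<L})" by blast
  then have "y \<in> F.span (e ` {..<Suc j})"
  proof (induction L)
    case 0
    then show ?case using F.span_mono[of "e ` {..<0}" "e ` {..<Suc j}"] by auto
  next
    case (Suc L)
    show ?case
    proof (cases "L \<le> j")
      case True
      then have "e ` {..<Suc L} \<subseteq> e ` {..<Suc j}" by auto
      then show ?thesis using Suc(2) F.span_mono by blast
    next
      case False
      then have "(D ^^ L) y = 0" using Dn_eq_0[OF zero] by simp
      moreover obtain g where g: "y - at_F g * e L \<in> F.span (e ` {..<L})"
          "(D ^^ L) y = at_F g * (D ^^ L) (e L)"
        using split[OF Suc(2)] by blast
      ultimately have "at_F g = 0" using e[of L] by simp
      then show ?thesis using g(1) Suc(1) by simp
    qed
  qed
  then show ?thesis by (rule split)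
qed

section \<open>The first image ideal\<close>

lemma dvd_range:
  assumes "q dvd a" "\<And>j. j \<ge> 1 \<Longrightarrow> q dvd coeff f j"
  shows "scalar q dvd D z"
proof (induction z rule: poly_poly_induct)
  case 3
  have "[:q:] dvd pderiv f" using assms(2) by (simp add: const_poly_dvd_iff coeff_pderiv)
  then have "[:[:q:]:] dvd [:pderiv f:]" by (auto elim!: dvdE)
  then show ?case by (simp add: D_X2 scalar_def)
qed (use assms(1) scalar_dvd in \<open>auto simp: D_scalar D_X1 D_add D_mult\<close>)

text \<open>
  Otherwise \<open>q\<close> would divide both \<open>D X1\<close> and \<open>D X2\<close>, hence the whole image of \<open>D\<close>.
\<close>

lemma irreducible_coeff:
  assumes "irreducible_derivation D" "prime_elem q" "q dvd a"
  shows "\<exists>j\<ge>1. \<not> q dvd coeff f j"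
proof (rule ccontr)
  assume "\<not> (\<exists>j\<ge>1. \<not> q dvd coeff f j)"
  then have "scalar q dvd D z" for z using dvd_range assms(3) by blast
  then have "range D \<subseteq> {scalar q * x | x. True}" by (auto elim!: dvdE)
  moreover have "\<not> scalar q dvd 1"
  proof
    assume "scalar q dvd 1"
    then have "q dvd 1" by (simp only: scalar_def is_unit_const_poly_iff)
    then show False using assms(2) by (simp add: prime_elem_def)
  qed
  ultimately show False using assms(1) unfolding irreducible_derivation_def by blast
qed

text \<open>
  If \<open>\<alpha> = D y\<close> is a constant, then some \<open>a\<^sup>N y\<close> has the form \<open>g(F) X1 + h(F)\<close>, because
  \<open>a X2 = F - f(X1)\<close>. Setting \<open>X2 = 0\<close> turns \<open>F\<close> into \<open>f\<close>, so \<open>b\<^sup>N\<close> divides \<open>X1 g(f) + h(f)\<close> in \<open>R[X1]\<close>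
  and therefore \<open>g\<close>. Differentiating gives \<open>a\<^sup>N \<alpha> = a g(F)\<close>, from which \<open>b\<^sup>N\<close> cancels; the remaining
  factor \<open>c\<^sup>N\<close> on the left is comaximal with \<open>b\<close>.
\<close>

lemma image_ideal_one_dvd:
  assumes a: "a = b * c" and b: "separates_content f b" and co: "comaximal c b"
    and \<alpha>: "\<alpha> \<in> image_ideal D 1"
  shows "scalar b dvd \<alpha>"
proof -
  obtain y where y: "D y = \<alpha>" and D\<alpha>: "D \<alpha> = 0" using \<alpha> unfolding image_ideal_iff by auto
  define e :: "nat \<Rightarrow> 'r poly poly" where "e l = X1 ^ l" for l
  have lead: "leads l (e l) (scalar a ^ l)" for l
    using leads_power[OF leads_X1, of l] by (simp add: e_def)
  have e: "(D ^^ l) (e l) \<noteq> 0 \<and> D ((D ^^ l) (e l)) = 0" for l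
    using leads_nonzero[OF lead] a_nonzero by (simp add: scalar_eq_0_iff)
  have X1e: "X1 * u \<in> F.span (range e)" if "u \<in> F.span (range e)" for u
    using that by (rule span_mult_generators[rotated])
      (auto simp: e_def intro!: F.span_base simp flip: power_Suc)
  have inner: "[:h:] * u \<in> F.span (range e)" if "u \<in> F.span (range e)" for h u
  proof (induction h)
    case 0
    show ?case by (simp add: F.span_zero)
  next
    case (pCons k h)
    have "[:pCons k h:] * u = scalar k * u + X1 * ([:h:] * u)"
      by (simp add: scalar_def X1_def algebra_simps flip: smult_add_left)
    then show ?case using pCons that by (metis F.span_add span_scalar X1e)
  qed
  have "\<exists>N. scalar (a ^ N) * y \<in> F.span (range e)"
  proof (rule multiple_in_span)
    have "1 = e 0" by (simp add: e_def)
    then show "1 \<in> F.span (range e)" by (metis F.span_base rangeI)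
    fix x assume "x \<in> range e"
    then have x: "x \<in> F.span (range e)" by (rule F.span_base)
    then show "scalar a * X1 * x \<in> F.span (range e)"
      unfolding mult.assoc by (intro span_scalar X1e)
    have "scalar a * X2 * x = F * x - [:f:] * x" by (simp add: F_def algebra_simps)
    then show "scalar a * X2 * x \<in> F.span (range e)"
      using x by (metis F.span_diff span_F inner)
  qed
  then obtain N where N: "scalar (a ^ N) * y \<in> F.span (range e)" by blast
  have "(D ^^ Suc 1) (scalar (a ^ N) * y) = 0"
    by (simp add: D_scalar_mult y D\<alpha>)
  from leading_term[OF e N this] obtain g where
    g: "scalar (a ^ N) * y - at_F g * e 1 \<in> F.span (e ` {..<1})"
       "(D ^^ 1) (scalar (a ^ N) * y) = at_F g * (D ^^ 1) (e 1)" by blast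
  have "e ` {..<1} = {1}" by (auto simp: e_def)
  then obtain h where h: "scalar (a ^ N) * y - at_F g * X1 = at_F h"
    using g(1) by (auto simp: F.span_singleton scale_F_def e_def)
  have \<alpha>g: "scalar (a ^ N) * \<alpha> = at_F g * scalar a"
    using g(2) by (simp add: D_scalar_mult y e_def D_X1)
  have "poly (scalar (a ^ N) * y) 0 = poly (at_F h + at_F g * X1) 0"
    using h by (simp add: algebra_simps)
  then have "[:a ^ N:] * poly y 0 = [:0, 1:] * pcompose g f + pcompose h f"
    by (simp add: poly_at_F_0 scalar_def X1_def add.commute)
  moreover have "[:b ^ N:] dvd [:a ^ N:]" by (simp add: a power_mult_distrib)
  ultimately have "[:b ^ N:] dvd [:0, 1:] * pcompose g f + pcompose h f"
    by (metis dvd_mult2)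
  then have "[:b ^ N:] dvd g"
    using separates_content_power[OF b] unfolding separates_content_def by blast
  then obtain g' where "g = smult (b ^ N) g'" by (auto elim!: dvdE)
  then have "scalar (a ^ N) * \<alpha> = scalar (b ^ N) * at_F g' * scalar a"
    using \<alpha>g by (simp add: at_F_smult)
  then have "scalar (b ^ N) * (scalar (c ^ N) * \<alpha>) = scalar (b ^ N) * (scalar b * (scalar c * at_F g'))"
    by (simp add: a power_mult_distrib scalar_hom ac_simps)
  then have "scalar (c ^ N) * \<alpha> = scalar b * (scalar c * at_F g')"
    using b by (simp add: scalar_eq_0_iff separates_content_def)
  then have "scalar b dvd scalar (c ^ N) * \<alpha>" by simp
  moreover have "comaximal (scalar (c ^ N)) (scalar b)"
    using comaximal_scalar comaximal_powers[OF co, of N 1] by simp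
  ultimately show ?thesis by (rule comaximal_dvd_mult[rotated])
qed

text \<open>
  Write \<open>X1 = g(f) + c v\<close> in \<open>R[X1]\<close>. As \<open>f\<close> and \<open>F\<close> agree modulo \<open>a\<close>, hence modulo \<open>c\<close>, also
  \<open>X1 = g(F) + c y\<close> for some \<open>y\<close> in \<open>B\<close>. Differentiating, \<open>b c = c D y\<close>.
\<close>

lemma image_ideal_one_mem:
  assumes a: "a = b * c" and c: "generates_modulo f c"
  shows "scalar b \<in> image_ideal D 1"
proof -
  obtain g v where gv: "[:0, 1:] = pcompose g f + smult c v"
    using c unfolding generates_modulo_def by blast
  obtain w where w: "at_F g - [:pcompose g f:] = scalar a * w"
    using at_F_pcompose_dvd[of g] by (elim dvdE)
  have "X1 = [:pcompose g f:] + scalar c * [:v:]"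
    using gv by (simp add: X1_def scalar_def)
  then have "X1 = at_F g + scalar c * ([:v:] - scalar b * w)"
    using w by (simp add: a scalar_hom algebra_simps)
  then have "D X1 = scalar c * D ([:v:] - scalar b * w)"
    by (metis D_add D_at_F D_scalar_mult add_0)
  then have "scalar c * D ([:v:] - scalar b * w) = scalar c * scalar b"
    using D_X1 a by (metis scalar_hom(4) mult.commute)
  moreover have "scalar c \<noteq> 0" using a_nonzero by (simp add: a scalar_eq_0_iff)
  ultimately have "D ([:v:] - scalar b * w) = scalar b" by (metis mult_left_cancel)
  then show ?thesis unfolding image_ideal_iff by (auto simp: D_scalar)
qed

section \<open>The higher image ideals\<close>

text \<open>
  The products \<open>\<alpha> \<beta>\<close> of members of the \<open>i\<close>-th and \<open>j\<close>-th image ideals lie in the \<open>(i + j)\<close>-th one, so it suffices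
  to see that \<open>a\<close> belongs to the first and \<open>a\<^bsup>d-1\<^esup>\<close> to the \<open>d\<close>-th image ideal. From \<open>X2\<close> and \<open>X1\<^sup>d\<close> the
  latter contains \<open>f\<^sub>d a\<^bsup>d-1\<^esup>\<close> and \<open>a\<^sup>d\<close>, and \<open>f\<^sub>d\<close> and \<open>a\<close> are comaximal.
\<close>

lemma representation_mem:
  assumes co: "comaximal (lead_coeff f) a"
  shows "scalar a ^ (i1 + (degree f - 1) * i2) \<in> image_ideal D (i1 + degree f * i2)"
proof -
  have a1: "scalar a \<in> image_ideal D 1" using leads_X1 leads_image_ideal by blast
  let ?d = "degree f"
  have "scalar a ^ (?d - 1) \<in> image_ideal D ?d"
  proof (cases "?d = 0")
    case True
    \<comment> \<open>The truncated exponent makes the power equal to 1.\<close>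
    then show ?thesis by (simp add: image_ideal_iff D_1)
  next
    case False
    obtain u v where uv: "u * lead_coeff f + v * a = 1"
      using co unfolding comaximal_def by blast
    have "- scalar (lead_coeff f * a ^ (?d - 1)) \<in> image_ideal D ?d"
      using leads_X2 leads_image_ideal False by blast
    then have 1: "scalar (- u) * (- scalar (lead_coeff f * a ^ (?d - 1))) \<in> image_ideal D ?d"
      by (rule image_ideal_Ker_mult[rotated]) (simp add: Ker_def D_scalar)
    have "scalar a ^ ?d \<in> image_ideal D ?d" using image_ideal_power[OF a1, of ?d] by simp
    then have 2: "scalar v * scalar a ^ ?d \<in> image_ideal D ?d"
      by (rule image_ideal_Ker_mult[rotated]) (simp add: Ker_def D_scalar)
    have "scalar (- u) * (- scalar (lead_coeff f * a ^ (?d - 1))) + scalar v * scalar a ^ ?d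
        = scalar (u * lead_coeff f + v * a) * scalar a ^ (?d - 1)"
      using False by (cases ?d) (simp_all add: scalar_simps algebra_simps)
    then show ?thesis using image_ideal_add[OF 1 2] uv by (simp add: scalar_hom)
  qed
  then show ?thesis
    using image_ideal_mult[OF image_ideal_power[OF a1, of i1] image_ideal_power, of _ ?d i2]
    by (simp add: power_add power_mult)
qed

text \<open>
  Let \<open>t = f\<^sub>d\<close>. After localization at \<open>t\<close>, the polynomial \<open>F\<close> is, up to a unit, monic of degree \<open>d\<close>
  in \<open>X1\<close>, so that \<open>B\<close> is spanned over \<open>R[F]\<close> by the monomials \<open>X1\<^sup>i X2\<^sup>k\<close> with \<open>i < d\<close>. Numbering them by \<open>l = i + d k\<close>
  makes them triangular with respect to \<open>D\<close>, with top derivative a multiple of \<open>a\<^bsup>i + (d-1) k\<^esup>\<close>.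
  The leading coefficient of \<open>t\<^sup>N y\<close> then shows that this power of \<open>a\<close>, for \<open>l = j\<close>, divides \<open>t\<^sup>N D\<^sup>j y\<close>;
  and \<open>t\<close> is comaximal with \<open>a\<close>.
\<close>

lemma image_ideal_dvd:
  assumes co: "comaximal (lead_coeff f) a" and d: "degree f > 0"
    and \<alpha>: "\<alpha> \<in> image_ideal D j"
  shows "scalar a ^ (j mod degree f + (degree f - 1) * (j div degree f)) dvd \<alpha>"
proof -
  define d where "d = degree f"
  define t where "t = lead_coeff f"
  define \<mu> where "\<mu> l = l mod d + (d - 1) * (l div d)" for l
  define e :: "nat \<Rightarrow> 'r poly poly" where "e l = X1 ^ (l mod d) * X2 ^ (l div d)" for l
  have d0: "d > 0" using d d_def by simp
  have t0: "t \<noteq> 0" using d t_def by auto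
  have lead: "leads l (e l) (scalar a ^ (l mod d) * (- scalar (t * a ^ (d - 1))) ^ (l div d))" for l
    using leads_mult[OF leads_power[OF leads_X1, of "l mod d"] leads_power[OF leads_X2[OF d], of "l div d"]]
    by (simp add: e_def d_def t_def)
  have e: "(D ^^ l) (e l) \<noteq> 0 \<and> D ((D ^^ l) (e l)) = 0" for l
    using leads_nonzero[OF lead[of l]] a_nonzero t0 by (simp add: scalar_eq_0_iff)
  have e_dvd: "scalar a ^ \<mu> l dvd (D ^^ l) (e l)" for l
  proof -
    obtain m where "(D ^^ l) (e l) = of_nat m * (scalar a ^ (l mod d) * (- scalar (t * a ^ (d - 1))) ^ (l div d))"
      using lead[of l] unfolding leads_def by blast
    also have "\<dots> = scalar a ^ \<mu> l * (of_nat m * (- scalar t) ^ (l div d))"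
    proof -
      have "scalar a ^ \<mu> l = scalar a ^ (l mod d) * (scalar a ^ (d - 1)) ^ (l div d)"
        by (simp only: \<mu>_def power_add power_mult)
      moreover have "- scalar (t * a ^ (d - 1)) = - scalar t * scalar a ^ (d - 1)"
        by (simp add: scalar_simps)
      ultimately show ?thesis by (simp only: power_mult_distrib ac_simps)
    qed
    finally show ?thesis by simp
  qed
  have gen: "e l \<in> F.span (range e)" for l by (simp add: F.span_base)
  have gen': "X1 ^ i * X2 ^ k \<in> F.span (range e)" if "i < d" for i k
  proof -
    have "e (d * k + i) = X1 ^ i * X2 ^ k" using that by (simp add: e_def)
    then show ?thesis using gen by metis
  qed
  have "\<exists>N. scalar (t ^ N) * y \<in> F.span (range e)" for y
  proof (rule multiple_in_span)
    have "1 = e 0" by (simp add: e_def)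
    then show "1 \<in> F.span (range e)" using gen by metis
    fix x assume "x \<in> range e"
    then obtain i k where x: "x = X1 ^ i * X2 ^ k" "i < d" using d0 by (auto simp: e_def)
    show "scalar t * X2 * x \<in> F.span (range e)"
      unfolding mult.assoc
      using gen'[OF x(2), of "Suc k"] by (intro span_scalar) (simp add: x(1) ac_simps)
    show "scalar t * X1 * x \<in> F.span (range e)"
    proof (cases "Suc i < d")
      case True
      then show ?thesis unfolding mult.assoc
        using gen'[of "Suc i" k] by (intro span_scalar) (simp add: x(1) ac_simps)
    next
      case False
      then have i: "Suc i = d" using x(2) by simp
      \<comment> \<open>Reduce X1^d by means of t X1^d = F - a X2 - (lower terms of f).\<close>
      have f: "[:f:] = (\<Sum>i<d. scalar (coeff f i) * X1 ^ i) + scalar t * X1 ^ d"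
      proof -
        have "[:g:] = (\<Sum>i\<le>degree g. scalar (coeff g i) * X1 ^ i)" for g :: "'r poly"
        proof -
          have sum: "[:sum h K:] = (\<Sum>i\<in>K. [:h i:])" for h :: "nat \<Rightarrow> 'r poly" and K
            by (rule poly_eqI) (simp add: coeff_sum coeff_pCons split: nat.split)
          have "(X1 :: 'r poly poly) ^ i = [:monom 1 i:]" for i
            by (induction i) (simp_all add: X1_def monom_Suc one_pCons)
          then have "(\<Sum>i\<le>degree g. scalar (coeff g i) * X1 ^ i) = (\<Sum>i\<le>degree g. [:monom (coeff g i) i:])"
            by (simp add: scalar_def smult_monom)
          then show ?thesis by (simp add: poly_as_sum_of_monoms flip: sum)
        qed
        from this[of f] show ?thesis by (simp add: d_def t_def flip: lessThan_Suc_atMost)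
      qed
      have "scalar t * X1 * x = scalar t * X1 ^ d * X2 ^ k"
        by (simp add: x(1) ac_simps flip: i)
      also have "\<dots> = F * (X1 ^ 0 * X2 ^ k) - scalar a * (X1 ^ 0 * X2 ^ Suc k)
          - (\<Sum>i<d. scalar (coeff f i) * (X1 ^ i * X2 ^ k))"
        by (simp add: F_def f algebra_simps sum_distrib_left)
      also have "\<dots> \<in> F.span (range e)"
        using d0 by (intro F.span_diff F.span_sum span_scalar span_F gen') auto
      finally show ?thesis .
    qed
  qed
  moreover obtain y where y: "(D ^^ j) y = \<alpha>" "D \<alpha> = 0" using \<alpha> unfolding image_ideal_iff by auto
  ultimately obtain N where N: "scalar (t ^ N) * y \<in> F.span (range e)" by blast
  have Dj: "(D ^^ j) (scalar (t ^ N) * y) = scalar (t ^ N) * \<alpha>"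
    using y by (simp add: Dn_Ker_mult D_scalar)
  then have "(D ^^ Suc j) (scalar (t ^ N) * y) = 0"
    using y(2) by (simp add: D_scalar_mult)
  from leading_term[OF e N this] Dj e_dvd[of j] have "scalar a ^ \<mu> j dvd scalar (t ^ N) * \<alpha>"
    by (metis dvd_mult)
  moreover have "comaximal (scalar (t ^ N)) (scalar a ^ \<mu> j)"
    using comaximal_scalar[OF comaximal_powers[OF co, of N "\<mu> j"]]
    by (simp only: t_def scalar_power)
  ultimately have "scalar a ^ \<mu> j dvd \<alpha>" by (rule comaximal_dvd_mult[rotated])
  then show ?thesis by (simp only: \<mu>_def d_def)
qed

end

section \<open>The structure of the image ideals\<close>

lemma min_exponent_attained:
  "\<exists>i1 i2. i1 + d * i2 = j \<and> min_exponent d j = i1 + (d - 1) * i2"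
  and min_exponent_le: "i1 + d * i2 = j \<Longrightarrow> min_exponent d j \<le> i1 + (d - 1) * i2"
proof -
  let ?S = "{i1 + (d - 1) * i2 | i1 i2. i1 + d * i2 = j}"
  have "x \<le> j" if "x \<in> ?S" for x
  proof -
    from that obtain i1 i2 where "x = i1 + (d - 1) * i2" "i1 + d * i2 = j" by blast
    moreover have "(d - 1) * i2 \<le> d * i2" by simp
    ultimately show ?thesis by linarith
  qed
  then have fin: "finite ?S" by (meson finite_nat_set_iff_bounded_le)
  have "j + d * 0 = j" by simp
  then have "?S \<noteq> {}" by blast
  then show "\<exists>i1 i2. i1 + d * i2 = j \<and> min_exponent d j = i1 + (d - 1) * i2"
    using Min_in[OF fin] unfolding min_exponent_def by blast
  show "i1 + d * i2 = j \<Longrightarrow> min_exponent d j \<le> i1 + (d - 1) * i2" for i1 i2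
    unfolding min_exponent_def using fin by (intro Min_le) auto
qed

theorem theorem5p9:
  fixes \<iota> :: "'k::field_char_0 \<Rightarrow> 'r::principal_ideal_domain"
    and D :: "'r poly poly \<Rightarrow> 'r poly poly"
    and n d :: nat
    and p :: "nat \<Rightarrow> 'r"
    and r :: "nat \<Rightarrow> nat"
    and f :: "'r poly"
    and I J :: "nat set"
    and A :: "'r poly poly set"
  assumes k_sub_R: "ring_embedding \<iota>"
    and derivation: "derivation_over scalar D"
    and nilpotent: "locally_nilpotent D"
    and irreducible: "irreducible_derivation D"
    and I_eq: "I = {1..n}"
    and primes: "\<And>i. i \<in> I \<Longrightarrow> prime_elem (p i)"
    and exponents: "\<And>i. i \<in> I \<Longrightarrow> r i > 0"
    and D_X1: "D X1 = scalar (\<Prod>i\<in>I. p i ^ r i)"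
    and f_degree: "degree f = d"
    and f_d: "coeff f d \<noteq> 0"
    and D_X2: "D X2 = - [:pderiv f:]"
    and A_eq: "A = Ker D"
    and J_eq: "J = {i \<in> I. (\<forall>j\<in>{2..d}. p i dvd coeff f j) \<and> \<not> p i dvd coeff f 1}"
  shows "(J \<noteq> I \<longrightarrow> image_ideal D 1 = {scalar (\<Prod>i\<in>I - J. p i ^ r i) * a | a. a \<in> A}) \<and>
         (J = I \<longrightarrow> image_ideal D 1 = A) \<and>
         ((\<forall>i\<in>I. \<not> p i dvd coeff f d) \<longrightarrow>
            (\<forall>j\<ge>1. image_ideal D j = {D X1 ^ min_exponent d j * a | a. a \<in> A}))"
proof -
  define a where "a = (\<Prod>i\<in>I. p i ^ r i)"
  define b where "b = (\<Prod>i\<in>I - J. p i ^ r i)"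
  define c where "c = (\<Prod>i\<in>J. p i ^ r i)"
  have finI: "finite I" using I_eq by simp
  have JI: "J \<subseteq> I" using J_eq by blast
  have a_nonzero: "a \<noteq> 0"
    unfolding a_def using finI primes by (auto dest: prime_elem_not_zeroI)
  interpret triangular_derivation D a f
    using derivation D_X1 D_X2 a_nonzero of_nat_dvd_one[OF k_sub_R]
    by unfold_locales (simp_all add: a_def)
  have abc: "a = b * c"
    unfolding a_def b_def c_def using prod.subset_diff[OF JI finI, of "\<lambda>i. p i ^ r i"] by simp
  have p_dvd_a: "p i dvd a" if "i \<in> I" for i
  proof -
    have "p i dvd p i ^ r i" using exponents[OF that] by simp
    also have "\<dots> dvd a" unfolding a_def using finI that by (rule dvd_prodI)
    finally show ?thesis .
  qed
  have coeff_exists: "\<exists>j\<ge>1. \<not> p i dvd coeff f j" if "i \<in> I" for i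
    using irreducible_coeff[OF irreducible primes p_dvd_a] that by blast
  have J_dvd: "p i dvd coeff f j" if "i \<in> J" "j \<ge> 2" for i j
    using that f_degree J_eq by (cases "j \<le> d") (auto simp: coeff_eq_0)
  have not_J: "\<exists>k\<ge>2. \<not> p i dvd coeff f k" if i: "i \<in> I - J" for i
  proof (rule ccontr)
    assume "\<not> ?thesis"
    then have all: "p i dvd coeff f k" if "k \<ge> 2" for k using that by blast
    then have 1: "p i dvd coeff f 1" using i J_eq by auto
    have "p i dvd coeff f j" if "j \<ge> 1" for j
      using 1 all[of j] that by (cases "j = 1") auto
    then show False using coeff_exists[of i] i by blast
  qed
  have b: "separates_content f b"
    unfolding b_def
    by (rule prod_power_closed)
      (use not_J primes in \<open>auto intro: separates_content_one separates_content_mult separates_content_prime\<close>)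
  have c: "generates_modulo f c"
    unfolding c_def
  proof (rule prod_power_closed)
    fix i assume i: "i \<in> J"
    then have "comaximal (coeff f 1) (p i)"
      using J_eq primes by (intro comaximal_prime) auto
    then show "generates_modulo f (p i)" using J_dvd i by (intro generates_modulo_linear)
  qed (auto intro: generates_modulo_one generates_modulo_mult)
  have cb: "comaximal c b"
    unfolding b_def
  proof (rule prod_power_closed)
    fix i assume i: "i \<in> I - J"
    have "comaximal (p i) c"
      unfolding c_def
    proof (rule prod_power_closed)
      fix l assume l: "l \<in> J"
      have "\<not> p i dvd p l" using J_dvd[OF l] not_J[OF i] dvd_trans by blast
      then have "comaximal (p l) (p i)" using i primes by (intro comaximal_prime) auto
      then show "comaximal (p i) (p l)" by (rule comaximal_sym)
    qed (auto intro: comaximal_one comaximal_mult)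
    then show "comaximal c (p i)" by (rule comaximal_sym)
  qed (auto intro: comaximal_one comaximal_mult)
  have I1: "image_ideal D 1 = {scalar b * x | x. x \<in> A}"
    unfolding A_eq
  proof (rule image_ideal_eq)
    show "scalar b \<noteq> 0" using b by (simp add: separates_content_def scalar_eq_0_iff)
    show "scalar b \<in> image_ideal D 1" using abc c by (rule image_ideal_one_mem)
    show "scalar b dvd \<alpha>" if "\<alpha> \<in> image_ideal D 1" for \<alpha>
      using abc b cb that by (rule image_ideal_one_dvd)
  qed
  have Ij: "image_ideal D j = {scalar a ^ min_exponent d j * x | x. x \<in> A}"
    if coeff_d: "\<forall>i\<in>I. \<not> p i dvd coeff f d" for j
    unfolding A_eq
  proof (rule image_ideal_eq)
    have co: "comaximal (lead_coeff f) a"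
      unfolding a_def f_degree
      by (rule prod_power_closed)
        (use coeff_d primes in \<open>auto intro: comaximal_one comaximal_mult comaximal_prime\<close>)
    show "scalar a ^ min_exponent d j \<noteq> 0" using a_nonzero by (simp add: scalar_eq_0_iff)
    obtain i1 i2 where "i1 + d * i2 = j" "min_exponent d j = i1 + (d - 1) * i2"
      using min_exponent_attained by blast
    then show "scalar a ^ min_exponent d j \<in> image_ideal D j"
      using representation_mem[OF co, of i1 i2] f_degree by simp
    fix \<alpha> assume \<alpha>: "\<alpha> \<in> image_ideal D j"
    \<comment> \<open>The representation j = (j mod d) + d (j div d) is one of those over which the minimum is taken.\<close>
    show "scalar a ^ min_exponent d j dvd \<alpha>"
    proof (cases "d = 0")
      case True
      then have "coeff f j = 0" if "j \<ge> 1" for j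
        using that f_degree by (simp add: coeff_eq_0)
      \<comment> \<open>Every p_i fails to divide some coefficient of positive index, and a constant f has only zeros there.\<close>
      then have "I = {}" using coeff_exists by (metis dvd_0_right equals0I)
      then show ?thesis by (simp add: a_def scalar_hom)
    next
      case False
      have "min_exponent d j \<le> j mod d + (d - 1) * (j div d)"
        by (rule min_exponent_le) simp
      then have "scalar a ^ min_exponent d j dvd scalar a ^ (j mod d + (d - 1) * (j div d))"
        by (rule le_imp_power_dvd)
      also have "\<dots> dvd \<alpha>" using image_ideal_dvd[OF co _ \<alpha>] False f_degree by simp
      finally show ?thesis .
    qed
  qed
  have "image_ideal D 1 = A" if "J = I"
    using I1 that by (simp add: b_def scalar_hom)
  moreover have "D X1 = scalar a" by (simp add: D_X1 a_def)
  ultimately show ?thesis using I1 Ij unfolding b_def by simp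
qed

end
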